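(* Let $(\mathcal{Y}_n)_{n\ge1}$ be the Hollywood process with parameter $(\alpha,\theta,\nu)$, where $0<\alpha<1$, $\theta>-\alpha$, and $\nu=(\nu_k)_{k\ge1}$ is a probability distribution on the positive integers with finite mean $\mu=\sum_{k\ge1}k\nu_k$. Then $$E(v(\mathcal{Y}_n))\sim\frac{\Gamma(\theta+1)}{\alpha\Gamma(\theta+\alpha)}(\mu n)^\alpha\quad\text{as }n\to\infty.$$ Furthermore, if $1/\mu<\alpha<1$, then $(\mathcal{Y}_n)_{n\ge1}$ is almost surely sparse, i.e. $\limsup_{n\to\infty}e(\mathcal{Y}_n)/v(\mathcal{Y}_n)^{m_\bullet(\mathcal{Y}_n)}=0$ almost surely.
   Context: Hollywood process with parameter $(\alpha,\theta,\nu)$: generate $X_1,X_2,\dots$ as follows. For each $n$, independently draw $K_n\sim\nu$; given $K_n=k$ choose $X_{n,1},\dots,X_{n,k}$ sequentially. Let $V_n(j)$ be the number of distinct labels among $X_1,\dots,X_{n-1},X_{n,1},\dots,X_{n,j-1}$ (labels $1,2,\dots$ assigned in order of first appearance), and for $i\le V_n(j)$ let $D_{n,j}(i)$ be the number of occurrences of label $i$ among these. Then $\mathrm{pr}(X_{n,j}=i\mid\text{past})\propto D_{n,j}(i)-\alpha$ for $i=1,\dots,V_n(j)$ and $\propto\theta+\alpha V_n(j)$ for $i=V_n(j)+1$. Set $X_n=(X_{n,1},\dots,X_{n,K_n})$ and let $\mathcal{Y}_n$ be the edge-labeled network (vertex labels forgotten, edge labels $1,\dots,n$ kept) with edges $X_1,\dots,X_n$.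 For an edge-labeled network $\mathcal{E}$: $v(\mathcal{E})$ is the number of distinct vertices appearing in its edges, $e(\mathcal{E})$ its number of edges, $M_k(\mathcal{E})$ the number of edges of arity (length) $k$, and $m_\bullet(\mathcal{E})=e(\mathcal{E})^{-1}\sum_{k\ge1}kM_k(\mathcal{E})$ the average arity. $\Gamma$ is the gamma function. *)

theory Defs
  imports "HOL-Probability.Probability" "HOL-Library.Landau_Symbols"
begin

text \<open>A network is represented by its list of edges X_1,...,X_n (edge label = position),
  each edge being the list of (vertex) labels of its entries. Vertex labels are
  1,2,... in order of first appearance.\<close>

text \<open>Next label, given the history h of all labels chosen so far (in order).
  V = card (set h), D(i) = count_list h i; weights D(i) - alpha for i \<le> V,
  theta + alpha V for i = V+1, normalised by their total length h + theta.
  For the empty history the only option is label 1.\<close>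
definition hw_label :: "real \<Rightarrow> real \<Rightarrow> nat list \<Rightarrow> nat pmf" where
  "hw_label \<alpha> \<theta> h =
     (if h = [] then return_pmf 1
      else embed_pmf (\<lambda>i.
        if 1 \<le> i \<and> i \<le> card (set h) then (real (count_list h i) - \<alpha>) / (real (length h) + \<theta>)
        else if i = card (set h) + 1 then (\<theta> + \<alpha> * real (card (set h))) / (real (length h) + \<theta>)
        else 0))"

fun hw_edge :: "real \<Rightarrow> real \<Rightarrow> nat list \<Rightarrow> nat \<Rightarrow> nat list pmf" where
  "hw_edge \<alpha> \<theta> h 0 = return_pmf []"
| "hw_edge \<alpha> \<theta> h (Suc k) =
     bind_pmf (hw_label \<alpha> \<theta> h) (\<lambda>x. map_pmf (\<lambda>xs. x # xs) (hw_edge \<alpha> \<theta> (h @ [x]) k))"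

fun hw_pmf :: "real \<Rightarrow> real \<Rightarrow> nat pmf \<Rightarrow> nat \<Rightarrow> nat list list pmf" where
  "hw_pmf \<alpha> \<theta> \<nu> 0 = return_pmf []"
| "hw_pmf \<alpha> \<theta> \<nu> (Suc n) =
     bind_pmf (hw_pmf \<alpha> \<theta> \<nu> n) (\<lambda>es.
       bind_pmf \<nu> (\<lambda>k. map_pmf (\<lambda>e. es @ [e]) (hw_edge \<alpha> \<theta> (concat es) k)))"

definition v_net :: "nat list list \<Rightarrow> nat" where
  "v_net es = card (set (concat es))"

definition e_net :: "nat list list \<Rightarrow> nat" where
  "e_net es = length es"

definition M_net :: "nat \<Rightarrow> nat list list \<Rightarrow> nat" where
  "M_net k es = length (filter (\<lambda>e. length e = k) es)"

definition m_avg :: "nat list list \<Rightarrow> real" where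
  "m_avg es = (\<Sum>k\<le>Max (insert 0 (length ` set es)). real k * real (M_net k es)) / real (e_net es)"

end

theory Submission
  imports Defs
begin

text \<open>Conditionally on the total arity \<open>S\<^sub>n = K\<^sub>1 + ... + K\<^sub>n\<close>, the vertices seen so far are the tables
  of a Chinese restaurant with \<open>S\<^sub>n\<close> customers. If V is the number of tables after s customers, then
  the rising factorial \<open>\<Gamma>(V + \<theta>/\<alpha> + p) / \<Gamma>(V + \<theta>/\<alpha>)\<close> has conditional mean growth factor exactly
  \<open>1 + \<alpha> p / (s + \<theta>)\<close>, for every real p. The case p = 1 gives the mean number of tables,
  asymptotic to a constant times \<open>s\<^sup>\<alpha>\<close>. Since \<open>S\<^sub>n \<ge> n\<close>, it remains to compare the mean of \<open>S\<^sub>n\<^sup>\<alpha>\<close> with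
  \<open>(\<mu> n)\<^sup>\<alpha>\<close>: concavity gives the upper bound, and a Chernoff bound for the lower tail of \<open>S\<^sub>n\<close>, which
  needs only a finite mean because the arities are nonnegative, gives the lower bound.

  A negative p and Markov's inequality give a polynomial bound on the lower tail of V. This is
  summable along n = 2, 4, 8, ..., so by monotonicity V eventually exceeds \<open>(n/2)\<^sup>\<beta>\<close> almost surely
  for every \<open>\<beta> < \<alpha>\<close>. The Chernoff bound makes the average arity eventually exceed any \<open>x < \<mu>\<close>. Sparsity
  follows by choosing x and \<open>\<beta>\<close> with \<open>\<beta> x > 1\<close>.\<close>

section \<open>Ratios of rising factorials\<close>

text \<open>This is the quotient of rising factorials
  \<open>\<Gamma>(u + n + z) / \<Gamma>(u + n)\<close> normalised to be 1 at n = 0. Pochhammer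
  symbols keep one step of n rational while z may be any real, including negative.\<close>

definition poch_ratio :: "real \<Rightarrow> real \<Rightarrow> nat \<Rightarrow> real" where
  "poch_ratio u z n = pochhammer (u + z) n / pochhammer u n"

lemma poch_ratio_Suc: "poch_ratio u z (Suc n) = poch_ratio u z n * ((u + z + n) / (u + n))"
  by (simp add: poch_ratio_def pochhammer_rec' mult_ac)

lemma poch_ratio_pos: "0 < u \<Longrightarrow> 0 < u + z \<Longrightarrow> 0 < poch_ratio u z n"
  by (simp add: poch_ratio_def pochhammer_pos)

text \<open>In the quotient of the two Gamma series the factorials cancel and the exponentials
  combine to \<open>n powr - z\<close>.\<close>

lemma poch_ratio_LIMSEQ:
  assumes "0 < u" "0 < u + z"
  shows "(\<lambda>n. poch_ratio u z n / real n powr z) \<longlonglongrightarrow> Gamma u / Gamma (u + z)"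
proof -
  have "(\<lambda>n. Gamma_series' u n / Gamma_series' (u + z) n) \<longlonglongrightarrow> Gamma u / Gamma (u + z)"
    using Gamma_real_pos[OF assms(2)] by (intro tendsto_divide Gamma_series'_LIMSEQ) auto
  moreover have "eventually (\<lambda>n. Gamma_series' u n / Gamma_series' (u + z) n
      = poch_ratio u z n / real n powr z) sequentially"
    using eventually_gt_at_top[of 0]
  proof eventually_elim
    case (elim n)
    have "pochhammer u n > 0" "pochhammer (u + z) n > 0"
      using assms by (auto intro: pochhammer_pos)
    thus ?case using elim
      by (simp add: Gamma_series'_def poch_ratio_def powr_def field_simps flip: exp_add)
  qed
  ultimately show ?thesis
    by (rule Lim_transform_eventually)
qed

lemma poch_ratio_1: "0 < u \<Longrightarrow> poch_ratio u 1 n = (u + real n) / u"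
  using pochhammer_rec[of u n] pochhammer_rec'[of u n] pochhammer_pos[of u n]
  by (simp add: poch_ratio_def field_simps)

text \<open>The shifted normalisation fits the later use, where index m stands for m + 1 customers,
  and it avoids a zero denominator at n = 0.\<close>

lemma poch_ratio_LIMSEQ_Suc:
  assumes "0 < u" "0 < u + z"
  shows "(\<lambda>n. poch_ratio u z n / real (Suc n) powr z) \<longlonglongrightarrow> Gamma u / Gamma (u + z)"
proof -
  have "(\<lambda>n. (poch_ratio u z n / real n powr z) * (real n / real (Suc n)) powr z)
      \<longlonglongrightarrow> Gamma u / Gamma (u + z) * 1 powr z"
    by (intro tendsto_mult poch_ratio_LIMSEQ assms tendsto_powr LIMSEQ_n_over_Suc_n tendsto_const) auto
  moreover have "eventually (\<lambda>n. (poch_ratio u z n / real n powr z) * (real n / real (Suc n)) powr z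
      = poch_ratio u z n / real (Suc n) powr z) sequentially"
    using eventually_gt_at_top[of 0]
    by eventually_elim (simp add: powr_divide)
  ultimately show ?thesis
    by (simp add: tendsto_cong)
qed

text \<open>The normalised ratio is positive and tends to a nonzero limit, so both it and its
  inverse are bounded.\<close>

lemma poch_ratio_bounds:
  assumes "0 < u" "0 < u + z"
  obtains c C where "0 < c" "0 < C" "\<And>n. c * real (Suc n) powr z \<le> poch_ratio u z n"
    "\<And>n. poch_ratio u z n \<le> C * real (Suc n) powr z"
proof -
  define X where "X n = poch_ratio u z n / real (Suc n) powr z" for n
  have pos: "X n > 0" for n
    using poch_ratio_pos[OF assms] by (simp add: X_def)
  have lim: "X \<longlonglongrightarrow> Gamma u / Gamma (u + z)"
    unfolding X_def by (rule poch_ratio_LIMSEQ_Suc[OF assms])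
  hence "Bseq X"
    by (auto intro: convergent_imp_Bseq convergentI)
  then obtain C where C: "C > 0" "\<And>n. norm (X n) \<le> C"
    by (auto elim: BseqE)
  have "Gamma u / Gamma (u + z) \<noteq> 0"
    using Gamma_real_pos[OF assms(1)] Gamma_real_pos[OF assms(2)]
    by (metis divide_eq_0_iff less_irrefl)
  from tendsto_inverse[OF lim this] have "Bseq (\<lambda>n. inverse (X n))"
    by (auto intro: convergent_imp_Bseq convergentI)
  then obtain D where D: "D > 0" "\<And>n. norm (inverse (X n)) \<le> D"
    by (auto elim: BseqE)
  show ?thesis
  proof (rule that[of "inverse D" C])
    fix n
    have "inverse (X n) \<le> D"
      using D(2)[of n] pos[of n] by simp
    hence "inverse D \<le> X n"
      using pos[of n] D(1) by (metis inverse_inverse_eq inverse_positive_iff_positive le_imp_inverse_le)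
    thus "inverse D * real (Suc n) powr z \<le> poch_ratio u z n"
      by (simp add: X_def pos_le_divide_eq del: of_nat_Suc)
    have "X n \<le> C"
      using C(2)[of n] pos[of n] by simp
    thus "poch_ratio u z n \<le> C * real (Suc n) powr z"
      by (simp add: X_def pos_divide_le_eq del: of_nat_Suc)
  qed (use C D in auto)
qed

section \<open>Sums of independent arities\<close>

text \<open>The nonnegative integral of a mixture is always the iterated one. Integrability is only
  needed inside; if the outer integral is infinite, both sides are 0 by convention.\<close>

lemma expectation_bind_pmf_nonneg:
  fixes f :: "'b \<Rightarrow> real"
  assumes "\<And>y. 0 \<le> f y" "\<And>x. integrable (measure_pmf (N x)) f"
  shows "measure_pmf.expectation (bind_pmf M N) f
    = measure_pmf.expectation M (\<lambda>x. measure_pmf.expectation (N x) f)"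
proof -
  have "measure_pmf.expectation (bind_pmf M N) f = enn2real (\<integral>\<^sup>+x. \<integral>\<^sup>+y. ennreal (f y) \<partial>N x \<partial>M)"
    using assms by (simp add: integral_eq_nn_integral)
  also have "(\<lambda>x. \<integral>\<^sup>+y. ennreal (f y) \<partial>N x) = (\<lambda>x. ennreal (measure_pmf.expectation (N x) f))"
    using assms by (simp add: nn_integral_eq_integral)
  finally show ?thesis
    using assms by (simp add: integral_eq_nn_integral)
qed

text \<open>The right-hand side is the tangent of the concave power at x; the bound is weighted
  AM-GM for s / x and 1.\<close>

lemma powr_le_tangent:
  fixes s x a :: real
  assumes "0 < s" "0 < x" "0 < a" "a < 1"
  shows "s powr a \<le> x powr a * (1 + a * (s / x - 1))"
proof -
  have "(s / x) powr a * 1 powr (1 - a) \<le> a * (s / x) + (1 - a) * 1"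
    using assms by (intro Youngs_inequality_0) auto
  hence "(s / x) powr a \<le> 1 + a * (s / x - 1)"
    by (simp add: algebra_simps)
  hence "x powr a * (s / x) powr a \<le> x powr a * (1 + a * (s / x - 1))"
    by (intro mult_left_mono) auto
  thus ?thesis
    using assms by (simp add: powr_divide)
qed

text \<open>A linear majorant under a one-sided bound on u: this supplies the dominating function
  for difference quotients of exp.\<close>

lemma abs_exp_minus_1_le:
  fixes u :: real
  assumes "u \<le> b" "0 \<le> b"
  shows "\<bar>exp u - 1\<bar> \<le> \<bar>u\<bar> * exp b"
proof (cases "0 \<le> u")
  case True
  have "1 - u \<le> exp (- u)"
    using exp_ge_add_one_self[of "- u"] by simp
  hence "exp u * (1 - u) \<le> exp u * exp (- u)"
    by (intro mult_left_mono) auto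
  hence "exp u - 1 \<le> u * exp u"
    by (simp add: algebra_simps flip: exp_add)
  also have "\<dots> \<le> u * exp b"
    using True assms by (intro mult_left_mono) auto
  finally show ?thesis
    using True by simp
next
  case False
  have "\<bar>exp u - 1\<bar> = 1 - exp u"
    using False by simp
  also have "\<dots> \<le> \<bar>u\<bar> * 1"
    using False exp_ge_add_one_self[of u] by linarith
  also have "\<dots> \<le> \<bar>u\<bar> * exp b"
    using assms by (intro mult_left_mono) auto
  finally show ?thesis .
qed

lemma exp_difference_quotient_LIMSEQ:
  fixes y :: real
  shows "(\<lambda>i. (exp (y / real (Suc i)) - 1) * real (Suc i)) \<longlonglongrightarrow> y"
proof -
  have "((\<lambda>t. exp (t * y)) has_field_derivative y) (at 0)"
    by (auto intro!: derivative_eq_intros)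
  hence "(\<lambda>t. (exp (t * y) - 1) / t) \<midarrow>0\<rightarrow> y"
    by (simp add: DERIV_def)
  moreover have "filterlim (\<lambda>i. inverse (real (Suc i))) (at 0) sequentially"
    using LIMSEQ_inverse_real_of_nat by (intro filterlim_atI) auto
  ultimately have "(\<lambda>i. (exp (inverse (real (Suc i)) * y) - 1) / inverse (real (Suc i))) \<longlonglongrightarrow> y"
    by (rule filterlim_compose)
  thus ?thesis
    by (simp add: field_simps)
qed

section \<open>Total arity: mean, lower tail and fractional moments\<close>

fun arity_sum :: "nat pmf \<Rightarrow> nat \<Rightarrow> nat pmf" where
  "arity_sum \<nu> 0 = return_pmf 0"
| "arity_sum \<nu> (Suc n) = bind_pmf (arity_sum \<nu> n) (\<lambda>s. map_pmf (\<lambda>k. s + k) \<nu>)"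

lemma arity_sum_ge:
  assumes "pmf \<nu> 0 = 0" "s \<in> set_pmf (arity_sum \<nu> n)"
  shows "n \<le> s"
  using assms(2)
proof (induction n arbitrary: s)
  case (Suc n)
  then obtain t k where "t \<in> set_pmf (arity_sum \<nu> n)" "k \<in> set_pmf \<nu>" "s = t + k"
    by auto
  moreover have "k \<noteq> 0"
    using \<open>k \<in> set_pmf \<nu>\<close> assms(1) by (metis pmf_eq_0_set_pmf)
  ultimately show ?case
    using Suc.IH[of t] by auto
qed simp

lemma expectation_arity_sum:
  assumes "integrable (measure_pmf \<nu>) real"
  shows "integrable (measure_pmf (arity_sum \<nu> n)) real"
    and "measure_pmf.expectation (arity_sum \<nu> n) real = real n * measure_pmf.expectation \<nu> real"
proof -
  let ?\<mu> = "measure_pmf.expectation \<nu> real"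
  have mu: "?\<mu> \<ge> 0" by simp
  \<comment> \<open>Working in the extended nonnegative reals yields integrability and the value of
    the mean in one induction.\<close>
  have nn: "(\<integral>\<^sup>+s. ennreal (real s) \<partial>arity_sum \<nu> n) = ennreal (real n * ?\<mu>)"
  proof (induction n)
    case (Suc n)
    have "(\<integral>\<^sup>+s. ennreal (real s) \<partial>arity_sum \<nu> (Suc n)) =
        (\<integral>\<^sup>+s. (\<integral>\<^sup>+k. ennreal (real s) + ennreal (real k) \<partial>\<nu>) \<partial>arity_sum \<nu> n)"
      by simp
    also have "\<dots> = (\<integral>\<^sup>+s. ennreal (real s) + ennreal ?\<mu> \<partial>arity_sum \<nu> n)"
      using assms by (simp add: nn_integral_add nn_integral_eq_integral)
    also have "\<dots> = ennreal (real n * ?\<mu>) + ennreal ?\<mu>"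
      using Suc by (simp add: nn_integral_add)
    also have "\<dots> = ennreal (real (Suc n) * ?\<mu>)"
      using mu by (subst ennreal_plus[symmetric]) (auto simp: algebra_simps)
    finally show ?case .
  qed simp
  show "integrable (measure_pmf (arity_sum \<nu> n)) real"
    by (rule integrableI_nonneg) (simp_all add: nn)
  show "measure_pmf.expectation (arity_sum \<nu> n) real = real n * ?\<mu>"
    using nn mu by (subst integral_eq_nn_integral) auto
qed

text \<open>As a function of t, this moment is 1 at t = 0 and has right derivative x minus the mean
  there, which is negative. So some small t = 1 / (i + 1) brings it below 1.\<close>

lemma exponential_moment_less_1:
  assumes "integrable (measure_pmf \<nu>) real" "x < measure_pmf.expectation \<nu> real"
  obtains t where "0 < t" "measure_pmf.expectation \<nu> (\<lambda>k. exp (t * (x - real k))) < 1"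
proof -
  \<comment> \<open>The difference quotient of the exponential at 0 with increment 1 / (i +
    1).\<close>
  define F where "F i k = (exp ((x - real k) / real (Suc i)) - 1) * real (Suc i)" for i and k :: nat
  have int: "integrable (measure_pmf \<nu>) (\<lambda>k. x - real k)"
    using assms(1) by auto
  have intexp: "integrable (measure_pmf \<nu>) (\<lambda>k. exp ((x - real k) / real (Suc i)))" for i
    by (rule measure_pmf.integrable_const_bound[where B = "exp (\<bar>x\<bar> / real (Suc i))"])
       (auto intro!: divide_right_mono AE_pmfI)
  have "(\<lambda>i. measure_pmf.expectation \<nu> (F i)) \<longlonglongrightarrow> measure_pmf.expectation \<nu> (\<lambda>k. x - real k)"
  proof (rule integral_dominated_convergence[where w = "\<lambda>k. \<bar>x - real k\<bar> * exp \<bar>x\<bar>"])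
    show "AE k in measure_pmf \<nu>. (\<lambda>i. F i k) \<longlonglongrightarrow> x - real k"
      unfolding F_def by (intro AE_pmfI exp_difference_quotient_LIMSEQ)
    show "AE k in measure_pmf \<nu>. norm (F i k) \<le> \<bar>x - real k\<bar> * exp \<bar>x\<bar>" for i
    proof (intro AE_pmfI)
      fix k
      \<comment> \<open>Since k is nonnegative the exponent is bounded above uniformly in k and i; a
        finite mean therefore suffices for domination.\<close>
      have "(x - real k) / real (Suc i) \<le> \<bar>x\<bar> / 1"
        by (intro frac_le) auto
      hence "\<bar>exp ((x - real k) / real (Suc i)) - 1\<bar> \<le> \<bar>(x - real k) / real (Suc i)\<bar> * exp \<bar>x\<bar>"
        by (intro abs_exp_minus_1_le) auto
      hence "\<bar>exp ((x - real k) / real (Suc i)) - 1\<bar> * real (Suc i)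
          \<le> \<bar>(x - real k) / real (Suc i)\<bar> * exp \<bar>x\<bar> * real (Suc i)"
        by (intro mult_right_mono) auto
      thus "norm (F i k) \<le> \<bar>x - real k\<bar> * exp \<bar>x\<bar>"
        by (simp add: F_def abs_mult)
    qed
  qed (use int in auto)
  moreover have "measure_pmf.expectation \<nu> (\<lambda>k. x - real k) < 0"
    using assms by simp
  ultimately have "eventually (\<lambda>i. measure_pmf.expectation \<nu> (F i) < 0) sequentially"
    by (rule order_tendstoD(2))
  then obtain i where "measure_pmf.expectation \<nu> (F i) < 0"
    by (auto simp: eventually_sequentially)
  also have "measure_pmf.expectation \<nu> (F i)
      = (measure_pmf.expectation \<nu> (\<lambda>k. exp ((x - real k) / real (Suc i))) - 1) * real (Suc i)"
    using intexp[of i] unfolding F_def[abs_def] by (simp del: of_nat_Suc)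
  finally have "measure_pmf.expectation \<nu> (\<lambda>k. exp ((x - real k) / real (Suc i))) < 1"
    by (simp add: mult_less_0_iff del: of_nat_Suc)
  thus ?thesis
    by (intro that[of "1 / real (Suc i)"]) (auto simp del: of_nat_Suc)
qed

text \<open>Chernoff's bound: by independence the exponential moment of the sum is the n-th power of
  that of one arity.\<close>

lemma arity_sum_lower_tail:
  assumes "integrable (measure_pmf \<nu>) real" "x < measure_pmf.expectation \<nu> real"
  obtains \<rho> where "0 \<le> \<rho>" "\<rho> < 1"
    "\<And>n. measure_pmf.prob (arity_sum \<nu> n) {s. real s \<le> real n * x} \<le> \<rho> ^ n"
proof -
  obtain t where t: "0 < t" "measure_pmf.expectation \<nu> (\<lambda>k. exp (t * (x - real k))) < 1"
    using exponential_moment_less_1[OF assms] by blast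
  define \<rho> where "\<rho> = measure_pmf.expectation \<nu> (\<lambda>k. exp (t * (x - real k)))"
  have int: "integrable (measure_pmf p) (\<lambda>k. exp (t * (y - (z + real k))))" if "0 \<le> z" for p y z
    by (rule measure_pmf.integrable_const_bound[where B = "exp (t * y)"])
       (use t that in \<open>auto intro!: AE_pmfI\<close>)
  have moment: "measure_pmf.expectation (arity_sum \<nu> n) (\<lambda>s. exp (t * (real n * x - real s))) = \<rho> ^ n" for n
  proof (induction n)
    case (Suc n)
    have "measure_pmf.expectation (arity_sum \<nu> (Suc n)) (\<lambda>s. exp (t * (real (Suc n) * x - real s)))
       = measure_pmf.expectation (arity_sum \<nu> n) (\<lambda>s. measure_pmf.expectation \<nu>
           (\<lambda>k. exp (t * (real (Suc n) * x - real (s + k)))))"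
      using int[of "real _"] unfolding arity_sum.simps
      by (subst expectation_bind_pmf_nonneg) (simp_all add: integrable_map_pmf_eq)
    also have "\<dots> = measure_pmf.expectation (arity_sum \<nu> n) (\<lambda>s. measure_pmf.expectation \<nu>
           (\<lambda>k. exp (t * (real n * x - real s)) * exp (t * (x - real k))))"
      by (simp add: algebra_simps flip: exp_add)
    also have "\<dots> = \<rho> ^ Suc n"
      using Suc by (simp add: \<rho>_def)
    finally show ?case .
  qed simp
  show ?thesis
  proof (rule that[of \<rho>])
    fix n
    have "measure_pmf.prob (arity_sum \<nu> n) {s. real s \<le> real n * x}
        = measure_pmf.expectation (arity_sum \<nu> n) (indicator {s. real s \<le> real n * x})"
      by simp
    \<comment> \<open>On the event the exponent is nonnegative, so the exponential dominates the
      indicator.\<close>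
    also have "\<dots> \<le> measure_pmf.expectation (arity_sum \<nu> n) (\<lambda>s. exp (t * (real n * x - real s)))"
      using t int[of 0 "arity_sum \<nu> n" "real n * x"]
      by (intro integral_mono) (auto simp: indicator_def intro!: measure_pmf.integrable_const_bound[where B = 1])
    finally show "measure_pmf.prob (arity_sum \<nu> n) {s. real s \<le> real n * x} \<le> \<rho> ^ n"
      by (simp add: moment)
  qed (use t in \<open>auto simp: \<rho>_def\<close>)
qed

lemma integrable_powr_arity_sum:
  assumes "integrable (measure_pmf \<nu>) real" "0 < a" "a < 1"
  shows "integrable (measure_pmf (arity_sum \<nu> n)) (\<lambda>s. real s powr a)"
proof (rule Bochner_Integration.integrable_bound[OF expectation_arity_sum(1)[OF assms(1), of n]])
  have "real s powr a \<le> real s" for s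
    using powr_mono[of a 1 "real s"] assms by (cases "s = 0") auto
  thus "AE s in measure_pmf (arity_sum \<nu> n). norm (real s powr a) \<le> norm (real s)"
    by (intro AE_pmfI) auto
qed simp

lemma expectation_ge_1_pmf:
  assumes "pmf \<nu> 0 = 0" "integrable (measure_pmf \<nu>) real"
  shows "1 \<le> measure_pmf.expectation \<nu> real"
proof -
  have "k \<noteq> 0" if "k \<in> set_pmf \<nu>" for k
    using that assms(1) by (metis pmf_eq_0_set_pmf)
  hence "measure_pmf.expectation \<nu> (\<lambda>_. 1) \<le> measure_pmf.expectation \<nu> real"
    using assms(2) by (intro integral_mono_AE AE_pmfI) (auto simp: Suc_le_eq)
  thus ?thesis by simp
qed

text \<open>Jensen's inequality through the tangent at the mean: the linear term of the tangent then
  has mean zero.\<close>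

lemma expectation_powr_arity_sum_le:
  assumes "pmf \<nu> 0 = 0" "integrable (measure_pmf \<nu>) real" "0 < a" "a < 1" "n > 0"
  shows "measure_pmf.expectation (arity_sum \<nu> n) (\<lambda>s. real s powr a)
    \<le> (measure_pmf.expectation \<nu> real * real n) powr a"
proof -
  define x where "x = measure_pmf.expectation \<nu> real * real n"
  have x: "x > 0"
    using expectation_ge_1_pmf[OF assms(1,2)] assms(5) by (simp add: x_def)
  note int = expectation_arity_sum(1)[OF assms(2), of n]
  have "measure_pmf.expectation (arity_sum \<nu> n) (\<lambda>s. real s powr a)
      \<le> measure_pmf.expectation (arity_sum \<nu> n) (\<lambda>s. x powr a * (1 + a * (real s / x - 1)))"
  proof (intro integral_mono_AE AE_pmfI)
    fix s assume "s \<in> set_pmf (arity_sum \<nu> n)"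
    hence "s > 0"
      using arity_sum_ge[OF assms(1)] assms(5) by force
    thus "real s powr a \<le> x powr a * (1 + a * (real s / x - 1))"
      using x assms by (intro powr_le_tangent) auto
  qed (use int assms in \<open>auto intro!: integrable_powr_arity_sum\<close>)
  also have "\<dots> = x powr a * (1 + a * (measure_pmf.expectation (arity_sum \<nu> n) real / x - 1))"
    using int by simp
  also have "measure_pmf.expectation (arity_sum \<nu> n) real = x"
    using expectation_arity_sum(2)[OF assms(2), of n] by (simp add: x_def)
  finally show ?thesis
    using x unfolding x_def[symmetric] by simp
qed

lemma expectation_powr_arity_sum_LIMSEQ:
  assumes "pmf \<nu> 0 = 0" "integrable (measure_pmf \<nu>) real" "0 < a" "a < 1"
  shows "(\<lambda>n. measure_pmf.expectation (arity_sum \<nu> n) (\<lambda>s. real s powr a)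
    / (measure_pmf.expectation \<nu> real * real n) powr a) \<longlonglongrightarrow> 1"
proof (rule order_tendstoI)
  let ?\<mu> = "measure_pmf.expectation \<nu> real"
  let ?E = "\<lambda>n. measure_pmf.expectation (arity_sum \<nu> n) (\<lambda>s. real s powr a)"
  have mu: "?\<mu> > 0"
    using expectation_ge_1_pmf[OF assms(1,2)] by simp
  fix c :: real assume "1 < c"
  show "eventually (\<lambda>n. ?E n / (?\<mu> * real n) powr a < c) sequentially"
    using eventually_gt_at_top[of 0]
  proof eventually_elim
    case (elim n)
    have "?E n / (?\<mu> * real n) powr a \<le> 1"
      using expectation_powr_arity_sum_le[OF assms elim] mu elim by simp
    thus ?case using \<open>1 < c\<close> by simp
  qed
next
  let ?\<mu> = "measure_pmf.expectation \<nu> real"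
  let ?E = "\<lambda>n. measure_pmf.expectation (arity_sum \<nu> n) (\<lambda>s. real s powr a)"
  have mu: "?\<mu> > 0"
    using expectation_ge_1_pmf[OF assms(1,2)] by simp
  fix c :: real assume "c < 1"
  \<comment> \<open>A value strictly between c and 1; the maximum keeps it positive, so that it has
    an a-th root y below 1.\<close>
  define d where "d = (1 + max c 0) / 2"
  have d: "0 < d" "d < 1" "c < d"
    using \<open>c < 1\<close> by (auto simp: d_def)
  define y where "y = d powr (1 / a)"
  have y: "0 < y" "y < 1" "y powr a = d"
    using d assms powr_less_mono2[of "1 / a" d 1] by (auto simp: y_def powr_powr)
  have "?\<mu> * y < ?\<mu> * 1"
    using mu y by (intro mult_strict_left_mono) auto
  then obtain \<rho> where \<rho>: "0 \<le> \<rho>" "\<rho> < 1"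
    "\<And>n. measure_pmf.prob (arity_sum \<nu> n) {s. real s \<le> real n * (?\<mu> * y)} \<le> \<rho> ^ n"
    using arity_sum_lower_tail[OF assms(2), of "?\<mu> * y"] by auto
  have "(\<lambda>n. d * (1 - \<rho> ^ n)) \<longlonglongrightarrow> d * (1 - 0)"
    using \<rho> by (intro tendsto_intros LIMSEQ_power_zero) auto
  hence "eventually (\<lambda>n. c < d * (1 - \<rho> ^ n)) sequentially"
    using d by (intro order_tendstoD(1)) auto
  thus "eventually (\<lambda>n. c < ?E n / (?\<mu> * real n) powr a) sequentially"
    using eventually_gt_at_top[of 0]
  proof eventually_elim
    case (elim n)
    let ?A = "{s. real s \<le> real n * (?\<mu> * y)}"
    have "(?\<mu> * real n) powr a * (d * (1 - \<rho> ^ n)) \<le>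
        (?\<mu> * real n) powr a * (d * measure_pmf.prob (arity_sum \<nu> n) (- ?A))"
      using \<rho>(3)[of n] d measure_pmf.prob_compl[of ?A "arity_sum \<nu> n"]
      by (intro mult_left_mono) (auto simp: Compl_eq_Diff_UNIV)
    \<comment> \<open>The choice of y turns the factor d into the a-th power of the truncation
      level. Outside the rare event the sum exceeds that level.\<close>
    also have "\<dots> = measure_pmf.expectation (arity_sum \<nu> n)
        (\<lambda>s. (real n * (?\<mu> * y)) powr a * indicator (- ?A) s)"
      using mu y(1) elim by (simp add: powr_mult y(3) mult_ac)
    also have "\<dots> \<le> ?E n"
    proof (intro integral_mono)
      fix s
      show "(real n * (?\<mu> * y)) powr a * indicator (- ?A) s \<le> real s powr a"
        using mu y assms(3) by (auto simp: indicator_def intro!: powr_mono2)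
    qed (use assms in \<open>auto intro!: integrable_powr_arity_sum integrable_real_indicator
        simp: measure_pmf.emeasure_finite less_top[symmetric]\<close>)
    finally have "d * (1 - \<rho> ^ n) \<le> ?E n / (?\<mu> * real n) powr a"
      using mu elim by (simp add: field_simps)
    thus ?case using elim by simp
  qed
qed

section \<open>Decomposition of the process\<close>

text \<open>Label choices depend only on the labels chosen before, so the place where a sequence is
  cut into edges does not matter.\<close>

lemma hw_edge_add:
  "hw_edge \<alpha> \<theta> h (j + k) =
     bind_pmf (hw_edge \<alpha> \<theta> h j) (\<lambda>e. map_pmf (\<lambda>e'. e @ e') (hw_edge \<alpha> \<theta> (h @ e) k))"
  by (induction j arbitrary: h)
     (simp_all add: bind_return_pmf bind_return_pmf' map_pmf_def bind_assoc_pmf)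

text \<open>\<open>hw_edge\<close> recurses on the first label; splitting off the last one permits
  induction over successive customers.\<close>

lemma hw_edge_snoc:
  "hw_edge \<alpha> \<theta> [] (Suc k) =
     bind_pmf (hw_edge \<alpha> \<theta> [] k) (\<lambda>h. map_pmf (\<lambda>x. h @ [x]) (hw_label \<alpha> \<theta> h))"
  using hw_edge_add[of \<alpha> \<theta> "[]" k 1]
  by (simp add: bind_return_pmf map_pmf_def bind_assoc_pmf)

lemma map_concat_hw_pmf:
  "map_pmf concat (hw_pmf \<alpha> \<theta> \<nu> n) = bind_pmf (arity_sum \<nu> n) (hw_edge \<alpha> \<theta> [])"
proof (induction n)
  case 0
  show ?case by (simp add: bind_return_pmf)
next
  case (Suc n)
  have "map_pmf concat (hw_pmf \<alpha> \<theta> \<nu> (Suc n)) =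
      bind_pmf (map_pmf concat (hw_pmf \<alpha> \<theta> \<nu> n))
        (\<lambda>h. bind_pmf \<nu> (\<lambda>k. map_pmf (\<lambda>e. h @ e) (hw_edge \<alpha> \<theta> h k)))"
    by (simp add: bind_return_pmf map_pmf_def bind_assoc_pmf)
  also have "\<dots> = bind_pmf (arity_sum \<nu> n) (\<lambda>s. bind_pmf \<nu> (\<lambda>k.
        bind_pmf (hw_edge \<alpha> \<theta> [] s) (\<lambda>h. map_pmf (\<lambda>e. h @ e) (hw_edge \<alpha> \<theta> h k))))"
    \<comment> \<open>The new arity is independent of the history, so it may be drawn first and
      joined to the earlier arities.\<close>
    unfolding Suc bind_assoc_pmf by (subst (2) bind_commute_pmf) simp
  also have "\<dots> = bind_pmf (arity_sum \<nu> (Suc n)) (hw_edge \<alpha> \<theta> [])"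
    by (simp add: bind_return_pmf map_pmf_def bind_assoc_pmf hw_edge_add)
  finally show ?case .
qed

lemma length_hw_edge: "e \<in> set_pmf (hw_edge \<alpha> \<theta> h k) \<Longrightarrow> length e = k"
  by (induction k arbitrary: h e) auto

lemma map_length_concat_hw_pmf:
  "map_pmf (\<lambda>es. length (concat es)) (hw_pmf \<alpha> \<theta> \<nu> n) = arity_sum \<nu> n"
proof -
  have "map_pmf (\<lambda>es. length (concat es)) (hw_pmf \<alpha> \<theta> \<nu> n)
      = map_pmf length (map_pmf concat (hw_pmf \<alpha> \<theta> \<nu> n))"
    by (simp add: pmf.map_comp o_def)
  also have "\<dots> = bind_pmf (arity_sum \<nu> n) (\<lambda>s. map_pmf length (hw_edge \<alpha> \<theta> [] s))"
    by (simp add: map_concat_hw_pmf map_bind_pmf)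
  also have "\<dots> = bind_pmf (arity_sum \<nu> n) (\<lambda>s. map_pmf (\<lambda>_. s) (hw_edge \<alpha> \<theta> [] s))"
    by (intro bind_pmf_cong map_pmf_cong) (auto dest: length_hw_edge)
  also have "\<dots> = arity_sum \<nu> n"
    by (simp add: bind_return_pmf')
  finally show ?thesis .
qed

lemma m_avg_eq: "m_avg es = real (length (concat es)) / real (length es)"
proof -
  \<comment> \<open>An arbitrary bound N replaces the maximal arity, which would change along the
    induction over the edges.\<close>
  have "(\<Sum>k\<le>N. real k * real (M_net k es)) = real (length (concat es))"
    if "\<forall>e\<in>set es. length e \<le> N" for N
    using that
  proof (induction es)
    case (Cons e es)
    have "(\<Sum>k\<le>N. real k * real (M_net k (e # es)))
        = (\<Sum>k\<le>N. (if k = length e then real k else 0) + real k * real (M_net k es))"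
      by (intro sum.cong) (auto simp: M_net_def algebra_simps)
    also have "\<dots> = real (length e) + real (length (concat es))"
      using Cons by (simp add: sum.distrib)
    finally show ?case by simp
  qed (simp add: M_net_def)
  thus ?thesis
    unfolding m_avg_def e_net_def by simp
qed

section \<open>Label probabilities\<close>

locale hollywood =
  fixes \<alpha> \<theta> :: real
  assumes alpha_pos: "0 < \<alpha>" and alpha_less_1: "\<alpha> < 1" and theta_gt: "- \<alpha> < \<theta>"
begin

text \<open>The weights form a distribution: when the labels fill an initial interval, every old
  label occurs at least once, hence more than \<alpha> times. The counts add up to the length, and
  the terms \<alpha> V cancel.\<close>

lemma pmf_hw_label:
  assumes "h \<noteq> []" "set h = {1..card (set h)}"
  shows "pmf (hw_label \<alpha> \<theta> h) i =
     (if 1 \<le> i \<and> i \<le> card (set h) then (real (count_list h i) - \<alpha>) / (real (length h) + \<theta>)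
      else if i = card (set h) + 1 then (\<theta> + \<alpha> * real (card (set h))) / (real (length h) + \<theta>)
      else 0)"
    (is "_ = ?f i")
proof -
  define V where "V = card (set h)"
  have V: "set h = {1..V}" "1 \<le> V"
    using assms by (auto simp: V_def Suc_le_eq card_gt_0_iff)
  have len: "real (length h) + \<theta> > 0"
    using assms(1) theta_gt alpha_less_1 by (cases h) auto
  have "0 \<le> \<theta> + \<alpha> * real V"
    using V(2) theta_gt alpha_pos mult_left_mono[of 1 "real V" \<alpha>] by linarith
  moreover have "\<alpha> \<le> real (count_list h i)" if "1 \<le> i" "i \<le> V" for i
  proof -
    have "count_list h i \<noteq> 0"
      using that V by (simp add: count_list_0_iff)
    thus ?thesis using alpha_less_1 by linarith
  qed
  ultimately have nonneg: "0 \<le> ?f i" for i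
    using len by (auto simp: V_def[symmetric])
  have "(\<integral>\<^sup>+i. ennreal (?f i) \<partial>count_space UNIV) = (\<integral>\<^sup>+i. ennreal (?f i) \<partial>count_space {1..V+1})"
    by (rule nn_integral_count_space_eq) (auto simp: V_def[symmetric])
  also have "\<dots> = ennreal (\<Sum>i\<in>{1..V+1}. ?f i)"
    using nonneg by (simp only: nn_integral_count_space_finite[OF finite_atLeastAtMost] sum_ennreal)
  also have "(\<Sum>i\<in>{1..V+1}. ?f i) =
      (\<Sum>i\<in>{1..V}. (real (count_list h i) - \<alpha>) / (real (length h) + \<theta>))
      + (\<theta> + \<alpha> * real V) / (real (length h) + \<theta>)"
    by (simp add: V_def[symmetric])
  also have "(\<Sum>i\<in>{1..V}. (real (count_list h i) - \<alpha>) / (real (length h) + \<theta>)) =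
      (real (\<Sum>i\<in>{1..V}. count_list h i) - \<alpha> * real V) / (real (length h) + \<theta>)"
    by (simp add: sum_divide_distrib[symmetric] sum_subtractf)
  also have "(\<Sum>i\<in>{1..V}. count_list h i) = length h"
    using V by (intro sum_count_set) auto
  also have "(real (length h) - \<alpha> * real V) / (real (length h) + \<theta>)
      + (\<theta> + \<alpha> * real V) / (real (length h) + \<theta>) = 1"
    using len by (simp add: add_divide_distrib[symmetric])
  finally have "(\<integral>\<^sup>+i. ennreal (?f i) \<partial>count_space UNIV) = 1"
    by simp
  thus ?thesis
    using assms(1) nonneg unfolding hw_label_def by (simp add: pmf_embed_pmf)
qed

text \<open>A label outside 1, ..., V + 1 has probability zero, so reachable histories use an
  initial interval of labels. This provides the hypothesis of \<open>pmf_hw_label\<close>.\<close>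

lemma set_hw_history:
  "h \<in> set_pmf (hw_edge \<alpha> \<theta> [] s) \<Longrightarrow> set h = {1..card (set h)}"
proof (induction s arbitrary: h)
  case (Suc s)
  then obtain h' x where h: "h = h' @ [x]" "h' \<in> set_pmf (hw_edge \<alpha> \<theta> [] s)"
      "x \<in> set_pmf (hw_label \<alpha> \<theta> h')"
    unfolding hw_edge_snoc by auto
  note h' = Suc.IH[OF h(2)]
  have "1 \<le> x \<and> x \<le> card (set h') + 1"
  proof (cases "h' = []")
    case True
    thus ?thesis using h(3) by (simp add: hw_label_def)
  next
    case False
    have "pmf (hw_label \<alpha> \<theta> h') x \<noteq> 0"
      using h(3) by (simp add: set_pmf_iff)
    thus ?thesis
      unfolding pmf_hw_label[OF False h'] by (auto split: if_splits)
  qed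
  then consider "x \<in> set h'" | "x = card (set h') + 1" "x \<notin> set h'"
    using h' by (metis Suc_eq_plus1 atLeastAtMost_iff le_Suc_eq not_less_eq_eq)
  thus ?case
  proof cases
    case 1
    thus ?thesis using h' h(1) by (simp add: insert_absorb)
  next
    case 2
    have "set h = {1..Suc (card (set h'))}"
      using h' h(1) 2 by (auto simp: atLeastAtMostSuc_conv)
    thus ?thesis by simp
  qed
qed simp

lemma map_new_label:
  assumes "h \<in> set_pmf (hw_edge \<alpha> \<theta> [] s)" "s > 0"
  shows "map_pmf (\<lambda>x. x \<notin> set h) (hw_label \<alpha> \<theta> h) =
    bernoulli_pmf ((\<theta> + \<alpha> * real (card (set h))) / (real s + \<theta>))"
    (is "?l = bernoulli_pmf ?p")
proof -
  have s: "length h = s"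
    using assms(1) by (rule length_hw_edge)
  hence ne: "h \<noteq> []" using assms(2) by auto
  note h = set_hw_history[OF assms(1)]
  note P = pmf_hw_label[OF ne h]
  have "pmf ?l True = measure (hw_label \<alpha> \<theta> h) {x. x \<notin> set h}"
    by (simp add: pmf_map vimage_def)
  also have "\<dots> = measure (hw_label \<alpha> \<theta> h) {card (set h) + 1}"
  proof (rule measure_pmf.finite_measure_eq_AE, goal_cases)
    case 1
    show ?case
    proof (rule AE_pmfI)
      fix x assume "x \<in> set_pmf (hw_label \<alpha> \<theta> h)"
      hence "pmf (hw_label \<alpha> \<theta> h) x \<noteq> 0" by (simp add: set_pmf_iff)
      moreover have "x \<in> set h \<longleftrightarrow> 1 \<le> x \<and> x \<le> card (set h)"
        using h by (metis atLeastAtMost_iff)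
      ultimately show "x \<in> {x. x \<notin> set h} \<longleftrightarrow> x \<in> {card (set h) + 1}"
        unfolding P by (auto split: if_splits)
    qed
  qed auto
  also have "\<dots> = ?p"
    by (simp add: measure_pmf_single P s)
  finally have T: "pmf ?l True = ?p" .
  \<comment> \<open>\<open>bernoulli_pmf\<close> clamps its parameter to the unit interval. Being
    equal to a probability, this parameter is unaffected.\<close>
  have "0 \<le> ?p" "?p \<le> 1"
    using pmf_nonneg[of ?l True] pmf_le_1[of ?l True] unfolding T by auto
  hence T': "pmf ?l True = pmf (bernoulli_pmf ?p) True"
    using T by simp
  moreover have "pmf p False = 1 - pmf p True" for p :: "bool pmf"
    using sum_pmf_eq_1[of "UNIV :: bool set" p] by (simp add: eq_diff_eq) (simp add: UNIV_bool)
  ultimately show ?thesis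
    by (intro pmf_eqI) (metis (full_types))
qed

section \<open>The Markov chain of vertex counts\<close>

definition hw_vertices :: "nat \<Rightarrow> nat pmf" where
  "hw_vertices s = map_pmf (\<lambda>h. card (set h)) (hw_edge \<alpha> \<theta> [] s)"

lemma hw_vertices_1: "hw_vertices (Suc 0) = return_pmf 1"
  by (simp add: hw_vertices_def hw_label_def bind_return_pmf)

text \<open>The chance of a new label depends on the history only through its length and number of
  vertices, so the vertex count is itself a Markov chain.\<close>

lemma hw_vertices_Suc:
  assumes "s > 0"
  shows "hw_vertices (Suc s) = bind_pmf (hw_vertices s)
    (\<lambda>v. map_pmf (\<lambda>b. v + of_bool b) (bernoulli_pmf ((\<theta> + \<alpha> * real v) / (real s + \<theta>))))"
proof -
  have "hw_vertices (Suc s) = bind_pmf (hw_edge \<alpha> \<theta> [] s)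
      (\<lambda>h. map_pmf (\<lambda>b. card (set h) + of_bool b) (map_pmf (\<lambda>x. x \<notin> set h) (hw_label \<alpha> \<theta> h)))"
    unfolding hw_vertices_def hw_edge_snoc map_bind_pmf pmf.map_comp o_def
    by (intro bind_pmf_cong map_pmf_cong) (auto simp: card_insert_if)
  also have "\<dots> = bind_pmf (hw_edge \<alpha> \<theta> [] s) (\<lambda>h. map_pmf (\<lambda>b. card (set h) + of_bool b)
      (bernoulli_pmf ((\<theta> + \<alpha> * real (card (set h))) / (real s + \<theta>))))"
    using assms by (intro bind_pmf_cong) (simp_all add: map_new_label)
  finally show ?thesis
    by (simp add: hw_vertices_def bind_map_pmf)
qed

lemma set_hw_vertices: "set_pmf (hw_vertices (Suc s)) \<subseteq> {1..Suc s}"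
proof
  fix v assume "v \<in> set_pmf (hw_vertices (Suc s))"
  then obtain h where h: "h \<in> set_pmf (hw_edge \<alpha> \<theta> [] (Suc s))" "v = card (set h)"
    unfolding hw_vertices_def by auto
  thus "v \<in> {1..Suc s}"
    using length_hw_edge[OF h(1)] card_length[of h] by (cases h) (auto simp: Suc_le_eq card_gt_0_iff)
qed

text \<open>A new vertex multiplies the ratio by
  \<open>1 + \<alpha> * p / (\<theta> + \<alpha> * v)\<close> and occurs with probability
  \<open>(\<theta> + \<alpha> * v) / (s + \<theta>)\<close>; v cancels in the mean growth factor.
  The offsets make both sides 1 at the start, with one customer and one vertex.\<close>

lemma expectation_poch_ratio_hw_vertices:
  "measure_pmf.expectation (hw_vertices (Suc m)) (\<lambda>v. poch_ratio (1 + \<theta> / \<alpha>) p (v - 1))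
     = poch_ratio (1 + \<theta>) (\<alpha> * p) m"
proof (induction m)
  case 0
  show ?case by (simp add: hw_vertices_1 poch_ratio_def)
next
  case (Suc m)
  let ?g = "\<lambda>v. poch_ratio (1 + \<theta> / \<alpha>) p (v - 1)"
  let ?p = "\<lambda>v. (\<theta> + \<alpha> * real v) / (real (Suc m) + \<theta>)"
  have pos: "real (Suc m) + \<theta> > 0"
    using theta_gt alpha_less_1 by simp
  have step: "measure_pmf.expectation (map_pmf (\<lambda>b. v + of_bool b) (bernoulli_pmf (?p v))) ?g
      = ?g v * ((1 + \<theta> + \<alpha> * p + m) / (1 + \<theta> + m))"
    if v: "v \<in> {1..Suc m}" for v
  proof -
    have "\<theta> + \<alpha> * 1 \<le> \<theta> + \<alpha> * real v"
      using v alpha_pos by (intro add_left_mono mult_left_mono) auto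
    hence v1: "\<theta> + \<alpha> * real v > 0"
      using theta_gt by simp
    have "\<alpha> * real v \<le> 1 * real (Suc m)"
      using v alpha_pos alpha_less_1 by (intro mult_mono) auto
    hence v2: "?p v \<le> 1" "0 \<le> ?p v"
      using pos v1 by auto
    obtain w where w: "v = Suc w" using v by (cases v) auto
    have eq: "(1 + \<theta> / \<alpha> + p + w) / (1 + \<theta> / \<alpha> + w) = 1 + \<alpha> * p / (\<theta> + \<alpha> * real v)"
    proof -
      have "1 + \<theta> / \<alpha> + w = (\<theta> + \<alpha> * real v) / \<alpha>"
        using alpha_pos w by (simp add: field_simps)
      moreover have "1 + \<theta> / \<alpha> + p + w = (\<theta> + \<alpha> * real v) / \<alpha> + p"
        using calculation by simp
      ultimately show ?thesis
        using v1 alpha_pos by (simp only: add_divide_distrib[of _ p]) simp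
    qed
    have "measure_pmf.expectation (map_pmf (\<lambda>b. v + of_bool b) (bernoulli_pmf (?p v))) ?g
      = ?g (Suc v) * ?p v + ?g v * (1 - ?p v)"
      using v2 by simp
    also have "?g (Suc v) = ?g v * (1 + \<alpha> * p / (\<theta> + \<alpha> * real v))"
      unfolding eq[symmetric] by (simp add: w poch_ratio_Suc)
    also have "?g v * (1 + \<alpha> * p / (\<theta> + \<alpha> * real v)) * ?p v + ?g v * (1 - ?p v) =
       ?g v * (1 + (\<alpha> * p / (\<theta> + \<alpha> * real v)) * ?p v)"
      by (simp add: algebra_simps)
    also have "(\<alpha> * p / (\<theta> + \<alpha> * real v)) * ?p v = \<alpha> * p / (real (Suc m) + \<theta>)"
      using v1 by simp
    also have "1 + \<alpha> * p / (real (Suc m) + \<theta>) = (1 + \<theta> + \<alpha> * p + m) / (1 + \<theta> + m)"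
      using pos by (simp add: field_simps)
    finally show ?thesis .
  qed
  \<comment> \<open>The support is finite, so the expectation is a finite sum over states where
    \<open>step\<close> applies.\<close>
  have "measure_pmf.expectation (hw_vertices (Suc (Suc m))) ?g =
      (\<Sum>v\<in>{1..Suc m}. pmf (hw_vertices (Suc m)) v *
          (?g v * ((1 + \<theta> + \<alpha> * p + m) / (1 + \<theta> + m))))"
    unfolding hw_vertices_Suc[of "Suc m", OF zero_less_Suc]
    by (subst pmf_expectation_bind[of "{1..Suc m}"])
       (use set_hw_vertices step in \<open>auto simp del: integral_map_pmf intro!: sum.cong\<close>)
  also have "\<dots> = (\<Sum>v\<in>{1..Suc m}. pmf (hw_vertices (Suc m)) v *\<^sub>R ?g v)
      * ((1 + \<theta> + \<alpha> * p + m) / (1 + \<theta> + m))"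
    unfolding sum_distrib_right by (intro sum.cong) auto
  also have "(\<Sum>v\<in>{1..Suc m}. pmf (hw_vertices (Suc m)) v *\<^sub>R ?g v)
      = measure_pmf.expectation (hw_vertices (Suc m)) ?g"
    using set_hw_vertices[of m] by (subst integral_measure_pmf[of "{1..Suc m}"]) auto
  finally show ?case
    unfolding Suc poch_ratio_Suc by (simp add: add_ac)
qed

section \<open>Mean number of vertices\<close>

lemma map_v_net_hw_pmf: "map_pmf v_net (hw_pmf \<alpha> \<theta> \<nu> n) = bind_pmf (arity_sum \<nu> n) hw_vertices"
proof -
  have "map_pmf v_net (hw_pmf \<alpha> \<theta> \<nu> n)
      = map_pmf (\<lambda>h. card (set h)) (map_pmf concat (hw_pmf \<alpha> \<theta> \<nu> n))"
    by (simp add: pmf.map_comp o_def v_net_def[abs_def])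
  thus ?thesis
    by (simp add: map_concat_hw_pmf map_bind_pmf hw_vertices_def[abs_def])
qed

lemma integrable_hw_vertices: "integrable (measure_pmf (hw_vertices s)) (f :: nat \<Rightarrow> real)"
proof -
  have "finite (set_pmf (hw_vertices s))"
  proof (cases s)
    case 0
    thus ?thesis by (simp add: hw_vertices_def)
  next
    case (Suc m)
    thus ?thesis using set_hw_vertices[of m] finite_subset by auto
  qed
  thus ?thesis by (rule integrable_measure_pmf_finite)
qed

lemma one_plus_theta_div_alpha_pos: "0 < 1 + \<theta> / \<alpha>"
  using alpha_pos theta_gt by (simp add: field_simps)

text \<open>For p = 1 the ratio is affine in v, so the exact growth identity can be solved for the
  mean.\<close>

lemma expectation_hw_vertices:
  "measure_pmf.expectation (hw_vertices (Suc m)) real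
     = (1 + \<theta> / \<alpha>) * poch_ratio (1 + \<theta>) \<alpha> m - \<theta> / \<alpha>"
proof -
  have "measure_pmf.expectation (hw_vertices (Suc m)) real =
      measure_pmf.expectation (hw_vertices (Suc m))
        (\<lambda>v. (1 + \<theta> / \<alpha>) * poch_ratio (1 + \<theta> / \<alpha>) 1 (v - 1) - \<theta> / \<alpha>)"
  proof (intro integral_cong_AE AE_pmfI)
    fix v assume "v \<in> set_pmf (hw_vertices (Suc m))"
    hence "1 \<le> v" using set_hw_vertices[of m] by auto
    thus "real v = (1 + \<theta> / \<alpha>) * poch_ratio (1 + \<theta> / \<alpha>) 1 (v - 1) - \<theta> / \<alpha>"
      using one_plus_theta_div_alpha_pos by (simp add: poch_ratio_1 of_nat_diff)
  qed auto
  also have "\<dots> = (1 + \<theta> / \<alpha>) * measure_pmf.expectation (hw_vertices (Suc m))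
      (\<lambda>v. poch_ratio (1 + \<theta> / \<alpha>) 1 (v - 1)) - \<theta> / \<alpha>"
    by (simp add: integrable_hw_vertices)
  finally show ?thesis
    unfolding expectation_poch_ratio_hw_vertices by simp
qed

lemma expectation_hw_vertices_LIMSEQ:
  "(\<lambda>s. measure_pmf.expectation (hw_vertices s) real / real s powr \<alpha>)
     \<longlonglongrightarrow> Gamma (\<theta> + 1) / (\<alpha> * Gamma (\<theta> + \<alpha>))"
proof -
  have "(\<lambda>m. (1 + \<theta> / \<alpha>) * (poch_ratio (1 + \<theta>) \<alpha> m / real (Suc m) powr \<alpha>)
        - \<theta> / \<alpha> * real (Suc m) powr - \<alpha>)
      \<longlonglongrightarrow> (1 + \<theta> / \<alpha>) * (Gamma (1 + \<theta>) / Gamma (1 + \<theta> + \<alpha>)) - \<theta> / \<alpha> * 0"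
    using alpha_pos alpha_less_1 theta_gt
    by (intro tendsto_intros poch_ratio_LIMSEQ_Suc tendsto_neg_powr
          filterlim_compose[OF filterlim_real_sequentially filterlim_Suc]) auto
  also have "(\<lambda>m. (1 + \<theta> / \<alpha>) * (poch_ratio (1 + \<theta>) \<alpha> m / real (Suc m) powr \<alpha>)
        - \<theta> / \<alpha> * real (Suc m) powr - \<alpha>)
     = (\<lambda>m. measure_pmf.expectation (hw_vertices (Suc m)) real / real (Suc m) powr \<alpha>)"
    by (simp add: expectation_hw_vertices powr_minus_divide diff_divide_distrib del: of_nat_Suc)
  \<comment> \<open>The functional equation of Gamma at the positive point \<theta> + \<alpha>
    produces a factor that cancels the numerator of \<open>1 + \<theta> / \<alpha>\<close>.\<close>
  also have "(1 + \<theta> / \<alpha>) * (Gamma (1 + \<theta>) / Gamma (1 + \<theta> + \<alpha>)) - \<theta> / \<alpha> * 0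
      = Gamma (\<theta> + 1) / (\<alpha> * Gamma (\<theta> + \<alpha>))"
  proof -
    have "Gamma (1 + \<theta> + \<alpha>) = (\<theta> + \<alpha>) * Gamma (\<theta> + \<alpha>)"
      using Gamma_plus1[of "\<theta> + \<alpha>"] theta_gt by (simp add: add_ac nonpos_Ints_def)
    moreover have "1 + \<theta> / \<alpha> = (\<theta> + \<alpha>) / \<alpha>"
      using alpha_pos by (simp add: field_simps)
    ultimately show ?thesis
      using theta_gt by (simp add: add.commute)
  qed
  finally show ?thesis
    by (rule filterlim_sequentially_Suc[THEN iffD1])
qed

lemma expectation_v_net:
  "measure_pmf.expectation (hw_pmf \<alpha> \<theta> \<nu> n) (\<lambda>es. real (v_net es))
     = measure_pmf.expectation (arity_sum \<nu> n) (\<lambda>s. measure_pmf.expectation (hw_vertices s) real)"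
proof -
  have "measure_pmf.expectation (hw_pmf \<alpha> \<theta> \<nu> n) (\<lambda>es. real (v_net es))
      = measure_pmf.expectation (map_pmf v_net (hw_pmf \<alpha> \<theta> \<nu> n)) real"
    by simp
  thus ?thesis
    by (simp add: map_v_net_hw_pmf expectation_bind_pmf_nonneg integrable_hw_vertices)
qed

lemma expectation_v_net_asymp_equiv:
  assumes "pmf \<nu> 0 = 0" "integrable (measure_pmf \<nu>) real"
  shows "(\<lambda>n. measure_pmf.expectation (hw_pmf \<alpha> \<theta> \<nu> n) (\<lambda>es. real (v_net es)))
           \<sim>[at_top] (\<lambda>n. Gamma (\<theta> + 1) / (\<alpha> * Gamma (\<theta> + \<alpha>))
                          * (measure_pmf.expectation \<nu> real * real n) powr \<alpha>)"
proof -
  define \<mu> where "\<mu> = measure_pmf.expectation \<nu> real"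
  define C where "C = Gamma (\<theta> + 1) / (\<alpha> * Gamma (\<theta> + \<alpha>))"
  define a where "a s = measure_pmf.expectation (hw_vertices s) real" for s
  define A where "A n = measure_pmf.expectation (arity_sum \<nu> n) a" for n
  define B where "B n = measure_pmf.expectation (arity_sum \<nu> n) (\<lambda>s. real s powr \<alpha>)" for n
  have mu: "\<mu> > 0"
    using expectation_ge_1_pmf[OF assms] by (simp add: \<mu>_def)
  have C: "C > 0"
    using alpha_pos alpha_less_1 theta_gt by (auto simp: C_def intro!: divide_pos_pos mult_pos_pos Gamma_real_pos)
  have lim: "(\<lambda>s. a s / real s powr \<alpha>) \<longlonglongrightarrow> C"
    unfolding a_def C_def by (rule expectation_hw_vertices_LIMSEQ)
  have intB: "integrable (measure_pmf (arity_sum \<nu> n)) (\<lambda>s. real s powr \<alpha>)" for n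
    by (rule integrable_powr_arity_sum[OF assms(2) alpha_pos alpha_less_1])
  have Bpos: "B n > 0" if "n > 0" for n
  proof -
    have "measure_pmf.expectation (arity_sum \<nu> n) (\<lambda>_. 1) \<le> B n"
      unfolding B_def
    proof (intro integral_mono_AE AE_pmfI)
      fix s assume "s \<in> set_pmf (arity_sum \<nu> n)"
      hence "1 \<le> s" using arity_sum_ge[OF assms(1)] that by force
      thus "1 \<le> real s powr \<alpha>"
        using alpha_pos by (intro ge_one_powr_ge_zero) auto
    qed (use intB in auto)
    thus ?thesis by simp
  qed
  have "(\<lambda>n. A n / B n) \<longlonglongrightarrow> C"
  proof (rule LIMSEQ_I)
    fix \<epsilon> :: real assume \<epsilon>: "\<epsilon> > 0"
    have "eventually (\<lambda>s. dist (a s / real s powr \<alpha>) C < \<epsilon> / 2) sequentially"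
      using \<epsilon> by (intro tendstoD[OF lim]) auto
    then obtain N where N: "\<And>s. s \<ge> N \<Longrightarrow> dist (a s / real s powr \<alpha>) C < \<epsilon> / 2"
      by (auto simp: eventually_sequentially)
    show "\<exists>no. \<forall>n\<ge>no. norm (A n / B n - C) < \<epsilon>"
    proof (intro exI[of _ "max N 1"] allI impI)
      fix n assume n: "n \<ge> max N 1"
      \<comment> \<open>The total arity is at least n, so from n = N on its whole support lies where
        the asymptotic estimate for fixed s is already accurate.\<close>
      have close: "\<bar>a s - C * real s powr \<alpha>\<bar> \<le> \<epsilon> / 2 * real s powr \<alpha>"
        if "s \<in> set_pmf (arity_sum \<nu> n)" for s
      proof -
        have s: "s \<ge> N" "s > 0"
          using arity_sum_ge[OF assms(1) that] n by auto
        have "\<bar>a s / real s powr \<alpha> - C\<bar> * real s powr \<alpha> \<le> \<epsilon> / 2 * real s powr \<alpha>"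
          using N[OF s(1)] by (intro mult_right_mono) (auto simp: dist_real_def)
        also have "\<bar>a s / real s powr \<alpha> - C\<bar> * real s powr \<alpha> = \<bar>(a s / real s powr \<alpha> - C) * real s powr \<alpha>\<bar>"
          by (simp add: abs_mult)
        also have "(a s / real s powr \<alpha> - C) * real s powr \<alpha> = a s - C * real s powr \<alpha>"
          using s by (simp add: field_simps)
        finally show ?thesis .
      qed
      \<comment> \<open>Integrability of \<open>a\<close> is inferred from its closeness to the
        integrable function \<open>C * real s powr \<alpha>\<close>.\<close>
      have intd: "integrable (measure_pmf (arity_sum \<nu> n)) (\<lambda>s. a s - C * real s powr \<alpha>)"
      proof (rule Bochner_Integration.integrable_bound)
        show "integrable (measure_pmf (arity_sum \<nu> n)) (\<lambda>s. \<epsilon> / 2 * real s powr \<alpha>)"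
          using intB by simp
        show "AE s in measure_pmf (arity_sum \<nu> n).
            norm (a s - C * real s powr \<alpha>) \<le> norm (\<epsilon> / 2 * real s powr \<alpha>)"
          using close \<epsilon> by (intro AE_pmfI) (auto simp: abs_mult)
      qed simp
      have inta: "integrable (measure_pmf (arity_sum \<nu> n)) a"
        using Bochner_Integration.integrable_add[OF intd integrable_mult_right[where c = C, OF intB]] by simp
      have "\<bar>A n - C * B n\<bar> = \<bar>measure_pmf.expectation (arity_sum \<nu> n) (\<lambda>s. a s - C * real s powr \<alpha>)\<bar>"
        using inta intB by (simp add: A_def B_def)
      also have "\<dots> \<le> measure_pmf.expectation (arity_sum \<nu> n) (\<lambda>s. \<bar>a s - C * real s powr \<alpha>\<bar>)"
        by (rule integral_abs_bound)
      also have "\<dots> \<le> measure_pmf.expectation (arity_sum \<nu> n) (\<lambda>s. \<epsilon> / 2 * real s powr \<alpha>)"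
        using close intd intB by (intro integral_mono_AE AE_pmfI) auto
      also have "\<dots> = \<epsilon> / 2 * B n"
        by (simp add: B_def)
      also have "\<dots> < \<epsilon> * B n"
        using \<epsilon> Bpos[of n] n by simp
      finally have "\<bar>A n - C * B n\<bar> / B n < \<epsilon>"
        using Bpos[of n] n by (simp add: pos_divide_less_eq)
      moreover have "\<bar>A n - C * B n\<bar> / B n = \<bar>(A n - C * B n) / B n\<bar>"
        using Bpos[of n] n by (simp add: abs_divide)
      moreover have "(A n - C * B n) / B n = A n / B n - C"
        using Bpos[of n] n by (simp add: diff_divide_distrib)
      ultimately show "norm (A n / B n - C) < \<epsilon>" by simp
    qed
  qed
  moreover have "(\<lambda>n. B n / (\<mu> * real n) powr \<alpha>) \<longlonglongrightarrow> 1"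
    unfolding B_def \<mu>_def by (rule expectation_powr_arity_sum_LIMSEQ[OF assms alpha_pos alpha_less_1])
  ultimately have "(\<lambda>n. (A n / B n) * (B n / (\<mu> * real n) powr \<alpha>) / C) \<longlonglongrightarrow> C * 1 / C"
    using C by (intro tendsto_intros) auto
  moreover have "eventually (\<lambda>n. (A n / B n) * (B n / (\<mu> * real n) powr \<alpha>) / C
      = A n / (C * (\<mu> * real n) powr \<alpha>)) sequentially"
    using eventually_gt_at_top[of 0]
  proof eventually_elim
    case (elim n)
    thus ?case using Bpos[of n] by simp
  qed
  ultimately have "(\<lambda>n. A n / (C * (\<mu> * real n) powr \<alpha>)) \<longlonglongrightarrow> 1"
    using C by (simp add: tendsto_cong)
  hence "A \<sim>[at_top] (\<lambda>n. C * (\<mu> * real n) powr \<alpha>)"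
    by (rule asymp_equivI')
  thus ?thesis
    unfolding expectation_v_net A_def C_def \<mu>_def a_def .
qed

section \<open>Lower tail of the number of vertices\<close>

text \<open>Markov's inequality for the ratio of order -q: it is at least a multiple of
  \<open>v powr - q\<close>, hence large when v is small, while its mean is of order
  \<open>s powr (- \<alpha> * q)\<close>.\<close>

lemma hw_vertices_lower_tail:
  obtains q K where "0 < q" "0 < K"
    "\<And>s y. s > 0 \<Longrightarrow> 0 < y \<Longrightarrow>
      measure_pmf.prob (hw_vertices s) {v. real v \<le> y} \<le> K * (y / real s powr \<alpha>) powr q"
proof -
  define u where "u = 1 + \<theta> / \<alpha>"
  \<comment> \<open>Half of u keeps both first parameters, \<open>u - q\<close> and
    \<open>1 + \<theta> - \<alpha> * q\<close>, positive; the latter exceeds 1 - \<alpha>.\<close>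
  define q where "q = u / 2"
  have u: "0 < u" "0 < u + - q"
    using one_plus_theta_div_alpha_pos by (simp_all add: u_def[symmetric] q_def)
  have aq: "\<alpha> * q = (\<alpha> + \<theta>) / 2"
    using alpha_pos by (simp add: q_def u_def field_simps)
  obtain c where c: "0 < c" "\<And>n. c * real (Suc n) powr - q \<le> poch_ratio u (- q) n"
    using poch_ratio_bounds[OF u] by metis
  have "0 < 1 + \<theta>" "0 < 1 + \<theta> + \<alpha> * - q"
    using aq alpha_pos alpha_less_1 theta_gt by auto
  then obtain C where C: "0 < C"
    "\<And>n. poch_ratio (1 + \<theta>) (\<alpha> * - q) n \<le> C * real (Suc n) powr (\<alpha> * - q)"
    using poch_ratio_bounds by metis
  show ?thesis
  proof (rule that[of q "C / c"])
    fix s :: nat and y :: real assume s: "s > 0" and y: "0 < y"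
    then obtain m where m: "s = Suc m" by (cases s) auto
    have "c * y powr - q * measure_pmf.prob (hw_vertices s) {v. real v \<le> y}
        = measure_pmf.expectation (hw_vertices s) (\<lambda>v. c * y powr - q * indicator {v. real v \<le> y} v)"
      by simp
    also have "\<dots> \<le> measure_pmf.expectation (hw_vertices s) (\<lambda>v. poch_ratio u (- q) (v - 1))"
    proof (intro integral_mono_AE AE_pmfI)
      fix v assume "v \<in> set_pmf (hw_vertices s)"
      hence v: "1 \<le> v" using set_hw_vertices[of m] m by auto
      show "c * y powr - q * indicator {v. real v \<le> y} v \<le> poch_ratio u (- q) (v - 1)"
      proof (cases "real v \<le> y")
        case True
        have "c * y powr - q \<le> c * real v powr - q"
          using True v c(1) u by (intro mult_left_mono powr_mono2') (auto simp: q_def)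
        also have "\<dots> \<le> poch_ratio u (- q) (v - 1)"
          using c(2)[of "v - 1"] v by simp
        finally show ?thesis using True by simp
      next
        case False
        thus ?thesis using poch_ratio_pos[OF u, of "v - 1"] by simp
      qed
    qed (auto intro: integrable_hw_vertices)
    also have "\<dots> = poch_ratio (1 + \<theta>) (\<alpha> * - q) m"
      unfolding m u_def by (rule expectation_poch_ratio_hw_vertices)
    also have "\<dots> \<le> C * real s powr (\<alpha> * - q)"
      unfolding m by (rule C(2))
    finally have "measure_pmf.prob (hw_vertices s) {v. real v \<le> y}
        \<le> C * real s powr (\<alpha> * - q) / (c * y powr - q)"
      using c(1) y by (simp add: pos_le_divide_eq mult_ac)
    also have "\<dots> = C / c * (y / real s powr \<alpha>) powr q"
      using y s by (simp add: powr_divide powr_powr powr_minus field_simps)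
    finally show "measure_pmf.prob (hw_vertices s) {v. real v \<le> y} \<le> C / c * (y / real s powr \<alpha>) powr q" .
  qed (use c C u in \<open>auto simp: q_def\<close>)
qed

text \<open>Given total arity s the bound decreases in s, and s is at least n, so n may replace s
  before averaging.\<close>

lemma v_net_lower_tail:
  assumes "pmf \<nu> 0 = 0"
  obtains q K where "0 < q" "0 < K"
    "\<And>n y. n > 0 \<Longrightarrow> 0 < y \<Longrightarrow>
      measure_pmf.prob (hw_pmf \<alpha> \<theta> \<nu> n) {es. real (v_net es) \<le> y} \<le> K * (y / real n powr \<alpha>) powr q"
proof -
  obtain q K where qK: "0 < q" "0 < K"
    "\<And>s y. s > 0 \<Longrightarrow> 0 < y \<Longrightarrow>
      measure_pmf.prob (hw_vertices s) {v. real v \<le> y} \<le> K * (y / real s powr \<alpha>) powr q"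
    using hw_vertices_lower_tail by blast
  show ?thesis
  proof (rule that[OF qK(1,2)])
    fix n :: nat and y :: real assume n: "n > 0" and y: "0 < y"
    let ?b = "K * (y / real n powr \<alpha>) powr q"
    have "ennreal (measure_pmf.prob (hw_pmf \<alpha> \<theta> \<nu> n) {es. real (v_net es) \<le> y})
        = emeasure (map_pmf v_net (hw_pmf \<alpha> \<theta> \<nu> n)) {v. real v \<le> y}"
      by (simp add: measure_pmf.emeasure_eq_measure vimage_def)
    also have "\<dots> = (\<integral>\<^sup>+s. emeasure (hw_vertices s) {v. real v \<le> y} \<partial>arity_sum \<nu> n)"
      unfolding map_v_net_hw_pmf by simp
    also have "\<dots> \<le> (\<integral>\<^sup>+s. ennreal ?b \<partial>arity_sum \<nu> n)"
    proof (intro nn_integral_mono_AE AE_pmfI)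
      fix s assume "s \<in> set_pmf (arity_sum \<nu> n)"
      hence s: "n \<le> s" by (rule arity_sum_ge[OF assms])
      have "measure_pmf.prob (hw_vertices s) {v. real v \<le> y} \<le> K * (y / real s powr \<alpha>) powr q"
        using s n y by (intro qK(3)) auto
      also have "\<dots> \<le> ?b"
        using qK s n y alpha_pos
        by (intro mult_left_mono powr_mono2 divide_left_mono) auto
      finally show "emeasure (hw_vertices s) {v. real v \<le> y} \<le> ennreal ?b"
        by (simp add: measure_pmf.emeasure_eq_measure ennreal_leI)
    qed
    also have "\<dots> = ennreal ?b" by simp
    finally show "measure_pmf.prob (hw_pmf \<alpha> \<theta> \<nu> n) {es. real (v_net es) \<le> y} \<le> ?b"
      using qK(2) by (simp add: ennreal_le_iff)
  qed
qed

end

section \<open>Sparsity\<close>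

text \<open>The deterministic part of the argument. Between consecutive powers of two, monotonicity
  loses only a factor 2 inside the power, so the ratio is eventually at most
  \<open>2 * (real n / 2) powr (1 - \<beta> * x)\<close>, whose exponent is negative.\<close>

lemma edge_vertex_ratio_LIMSEQ:
  fixes v s :: "nat \<Rightarrow> nat" and x \<beta> :: real
  assumes "mono v" "0 < x" "0 < \<beta>" "1 < \<beta> * x"
    and v: "eventually (\<lambda>k. (2 ^ k) powr \<beta> < real (v (2 ^ k))) sequentially"
    and s: "eventually (\<lambda>n. real n * x < real (s n)) sequentially"
  shows "(\<lambda>n. real n / real (v n) powr (real (s n) / real n)) \<longlonglongrightarrow> 0"
proof -
  obtain k0 where k0: "\<And>k. k \<ge> k0 \<Longrightarrow> (2 ^ k) powr \<beta> < real (v (2 ^ k))"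
    using v by (auto simp: eventually_sequentially)
  have bound: "eventually (\<lambda>n. real n / real (v n) powr (real (s n) / real n)
      \<le> 2 * (real n / 2) powr (1 - \<beta> * x)) sequentially"
    using s eventually_ge_at_top[of "2 ^ Suc k0"]
  proof eventually_elim
    case (elim n)
    have n2: "n \<ge> 2"
      using elim(2) by (metis dual_order.trans one_le_numeral power_increasing power_one_right le_add1 plus_1_eq_Suc)
    then obtain k where k: "2 ^ k \<le> n" "n < 2 ^ (k + 1)"
      using ex_power_ivl1[of 2 n] by auto
    have "(2::nat) ^ Suc k0 < 2 ^ (k + 1)"
      using elim(2) k(2) by linarith
    hence "k \<ge> k0"
      by (subst (asm) power_strict_increasing_iff) auto
    have "real n < 2 ^ (k + 1)"
      using k(2) by (metis of_nat_less_iff of_nat_numeral of_nat_power)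
    hence "(real n / 2) powr \<beta> \<le> (2 ^ k) powr \<beta>"
      using assms(3) by (intro powr_mono2) auto
    also have "\<dots> \<le> real (v (2 ^ k))"
      using k0[OF \<open>k \<ge> k0\<close>] by simp
    also have "\<dots> \<le> real (v n)"
      using monoD[OF assms(1) k(1)] by simp
    finally have vn: "(real n / 2) powr \<beta> \<le> real (v n)" .
    have "1 \<le> (real n / 2) powr \<beta>"
      using n2 assms(3) by (intro ge_one_powr_ge_zero) auto
    hence v1: "1 \<le> real (v n)" using vn by linarith
    have "(real n / 2) powr (\<beta> * x) = ((real n / 2) powr \<beta>) powr x"
      by (simp add: powr_powr)
    also have "\<dots> \<le> real (v n) powr x"
      using vn assms(2) by (intro powr_mono2) auto
    \<comment> \<open>Raising the exponent from x to the average arity is safe because the base is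
      at least 1.\<close>
    also have "\<dots> \<le> real (v n) powr (real (s n) / real n)"
      using v1 elim(1) n2 by (intro powr_mono) (auto simp: field_simps)
    finally have "real n / real (v n) powr (real (s n) / real n) \<le> real n / (real n / 2) powr (\<beta> * x)"
      using n2 v1 by (intro divide_left_mono mult_pos_pos) auto
    also have "\<dots> = 2 * (real n / 2) powr (1 - \<beta> * x)"
      using n2 by (simp add: powr_diff)
    finally show ?case .
  qed
  have "filterlim (\<lambda>n. real n / 2) at_top sequentially"
    using filterlim_tendsto_pos_mult_at_top[OF tendsto_const[of "1/2"] _ filterlim_real_sequentially]
    by simp
  hence "(\<lambda>n. 2 * (real n / 2) powr (1 - \<beta> * x)) \<longlonglongrightarrow> 2 * 0"
    using assms(4) by (intro tendsto_mult tendsto_const tendsto_neg_powr) auto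
  hence "(\<lambda>n. 2 * (real n / 2) powr (1 - \<beta> * x)) \<longlonglongrightarrow> 0" by simp
  thus ?thesis
    by (rule tendsto_sandwich[OF _ bound tendsto_const, rotated]) simp
qed

text \<open>Countability of the values lets the head be fixed to each of its values in turn, so
  lists remain measurable for the discrete sigma-algebra.\<close>

lemma measurable_map_list:
  fixes X :: "'i \<Rightarrow> 'a \<Rightarrow> 'b :: countable"
  assumes "\<And>i. X i \<in> measurable M (count_space UNIV)"
  shows "(\<lambda>\<omega>. map (\<lambda>i. X i \<omega>) is) \<in> measurable M (count_space UNIV)"
proof (induction "is")
  case (Cons i "is")
  have "(\<lambda>\<omega>. x # map (\<lambda>i. X i \<omega>) is) \<in> measurable M (count_space UNIV)" for x
    using measurable_compose[OF Cons, of "\<lambda>xs. x # xs"] by simp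
  from measurable_compose_countable[OF this assms] show ?case by simp
qed simp

context hollywood
begin

text \<open>Borel-Cantelli is applied to two sequences of bad events: a total arity at most n x, for
  all n, and too few vertices, along powers of two. Their probabilities come from the law of each
  finite network.\<close>

lemma AE_sparse:
  fixes M :: "'a measure" and X :: "nat \<Rightarrow> 'a \<Rightarrow> nat list"
  assumes nu: "pmf \<nu> 0 = 0" "integrable (measure_pmf \<nu>) real"
    and mu: "1 / measure_pmf.expectation \<nu> real < \<alpha>"
    and "prob_space M"
    and X[measurable]: "\<And>i. X i \<in> measurable M (count_space UNIV)"
    and distr: "\<And>n. distr M (count_space UNIV) (\<lambda>\<omega>. map (\<lambda>i. X i \<omega>) [1..<Suc n])
                  = measure_pmf (hw_pmf \<alpha> \<theta> \<nu> n)"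
  shows "AE \<omega> in M. limsup (\<lambda>n. ereal (real (e_net (map (\<lambda>i. X i \<omega>) [1..<Suc n]))
                 / real (v_net (map (\<lambda>i. X i \<omega>) [1..<Suc n]))
                     powr m_avg (map (\<lambda>i. X i \<omega>) [1..<Suc n]))) = 0"
proof -
  interpret prob_space M by fact
  define Y where "Y n \<omega> = map (\<lambda>i. X i \<omega>) [1..<Suc n]" for n \<omega>
  define s where "s n \<omega> = length (concat (Y n \<omega>))" for n \<omega>
  define v where "v n \<omega> = v_net (Y n \<omega>)" for n \<omega>
  have Y[measurable]: "Y n \<in> measurable M (count_space UNIV)" for n
    unfolding Y_def by (rule measurable_map_list[OF X])
  have Y_prob: "prob {\<omega>\<in>space M. Y n \<omega> \<in> A} = measure_pmf.prob (hw_pmf \<alpha> \<theta> \<nu> n) A" for n A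
    unfolding distr[of n, folded Y_def, symmetric]
    by (subst measure_distr) (auto simp: vimage_def Int_def intro!: arg_cong[where f = prob])
  have "measure_pmf.expectation \<nu> real > 0"
    using expectation_ge_1_pmf[OF nu] by simp
  \<comment> \<open>The gap between 1 / \<alpha> and the mean leaves room for x, and then for
    \<beta> below \<alpha> with \<beta> x still above 1.\<close>
  hence "1 / \<alpha> < measure_pmf.expectation \<nu> real"
    using mu alpha_pos by (simp add: field_simps)
  then obtain x where x: "1 / \<alpha> < x" "x < measure_pmf.expectation \<nu> real"
    using dense by blast
  have x0: "0 < x" using x(1) alpha_pos by (meson less_trans zero_less_divide_1_iff)
  have "1 / x < \<alpha>" using x x0 alpha_pos by (simp add: field_simps)
  then obtain \<beta> where \<beta>: "1 / x < \<beta>" "\<beta> < \<alpha>"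
    using dense by blast
  have \<beta>0: "0 < \<beta>" using \<beta>(1) x0 by (meson less_trans zero_less_divide_1_iff)
  have \<beta>x: "1 < \<beta> * x" using \<beta>(1) x0 by (simp add: field_simps)
  obtain \<rho> where \<rho>: "0 \<le> \<rho>" "\<rho> < 1"
    "\<And>n. measure_pmf.prob (arity_sum \<nu> n) {s. real s \<le> real n * x} \<le> \<rho> ^ n"
    using arity_sum_lower_tail[OF nu(2) x(2)] by blast
  have "AE \<omega> in M. eventually (\<lambda>n. \<omega> \<in> space M - {\<omega>\<in>space M. real (s n \<omega>) \<le> real n * x}) sequentially"
  proof (rule borel_cantelli_AE1)
    fix n
    show "{\<omega>\<in>space M. real (s n \<omega>) \<le> real n * x} \<in> sets M"
      unfolding s_def by measurable
    show "emeasure M {\<omega>\<in>space M. real (s n \<omega>) \<le> real n * x} < \<infinity>"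
      by (simp add: emeasure_eq_measure)
  next
    have "prob {\<omega>\<in>space M. real (s n \<omega>) \<le> real n * x} \<le> \<rho> ^ n" for n
    proof -
      have "prob {\<omega>\<in>space M. real (s n \<omega>) \<le> real n * x}
          = measure_pmf.prob (hw_pmf \<alpha> \<theta> \<nu> n) {es. real (length (concat es)) \<le> real n * x}"
        using Y_prob[of n "{es. real (length (concat es)) \<le> real n * x}"] by (simp add: s_def)
      also have "\<dots> = measure_pmf.prob (map_pmf (\<lambda>es. length (concat es)) (hw_pmf \<alpha> \<theta> \<nu> n))
          {s. real s \<le> real n * x}"
        by (simp add: vimage_def)
      also have "\<dots> \<le> \<rho> ^ n"
        unfolding map_length_concat_hw_pmf by (rule \<rho>(3))
      finally show ?thesis .
    qed
    thus "summable (\<lambda>n. prob {\<omega>\<in>space M. real (s n \<omega>) \<le> real n * x})"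
      using \<rho> by (intro summable_comparison_test'[OF summable_geometric[of \<rho>]]) auto
  qed
  moreover obtain q K where qK: "0 < q" "0 < K"
    "\<And>n y. n > 0 \<Longrightarrow> 0 < y \<Longrightarrow>
      measure_pmf.prob (hw_pmf \<alpha> \<theta> \<nu> n) {es. real (v_net es) \<le> y} \<le> K * (y / real n powr \<alpha>) powr q"
    using v_net_lower_tail[OF nu(1)] by blast
  \<comment> \<open>Taking n = 2^k and y = n^\<beta> in the tail bound gives exactly K r^k. As
    \<beta> < \<alpha>, this is summable, whereas the same bound over all n need not be.\<close>
  define r :: real where "r = 2 powr ((\<beta> - \<alpha>) * q)"
  have r: "0 < r" "r < 1"
    using \<beta>(2) qK(1) by (auto simp: r_def mult_neg_pos intro!: powr_less_one)
  have "AE \<omega> in M. eventually (\<lambda>k. \<omega> \<in> space M -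
      {\<omega>\<in>space M. real (v (2 ^ k) \<omega>) \<le> (2 ^ k) powr \<beta>}) sequentially"
  proof (rule borel_cantelli_AE1)
    fix k :: nat
    show "{\<omega>\<in>space M. real (v (2 ^ k) \<omega>) \<le> (2 ^ k) powr \<beta>} \<in> sets M"
      unfolding v_def by measurable
    show "emeasure M {\<omega>\<in>space M. real (v (2 ^ k) \<omega>) \<le> (2 ^ k) powr \<beta>} < \<infinity>"
      by (simp add: emeasure_eq_measure)
  next
    have "prob {\<omega>\<in>space M. real (v (2 ^ k) \<omega>) \<le> (2 ^ k) powr \<beta>} \<le> K * r ^ k" for k :: nat
    proof -
      have "prob {\<omega>\<in>space M. real (v (2 ^ k) \<omega>) \<le> (2 ^ k) powr \<beta>}
          \<le> K * ((2 ^ k) powr \<beta> / real (2 ^ k) powr \<alpha>) powr q"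
        using Y_prob[of "2 ^ k" "{es. real (v_net es) \<le> (2 ^ k) powr \<beta>}"]
          qK(3)[of "2 ^ k" "(2 ^ k) powr \<beta>"] by (simp add: v_def)
      also have "((2 ^ k) powr \<beta> / real (2 ^ k) powr \<alpha>) powr q = r ^ k"
        by (simp add: r_def powr_powr powr_power algebra_simps flip: powr_realpow powr_diff)
      finally show ?thesis .
    qed
    thus "summable (\<lambda>k. prob {\<omega>\<in>space M. real (v (2 ^ k) \<omega>) \<le> (2 ^ k) powr \<beta>})"
      using r by (intro summable_comparison_test'[OF summable_mult[OF summable_geometric[of r], of K]]) auto
  qed
  ultimately show ?thesis
  proof eventually_elim
    case (elim \<omega>)
    \<comment> \<open>Each network is a prefix of the later ones, so along one outcome the vertex
      sets increase.\<close>
    have "mono (\<lambda>n. v n \<omega>)"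
      by (intro monoI card_mono) (auto simp: v_def v_net_def Y_def intro!: card_mono)
    moreover have "eventually (\<lambda>n. real n * x < real (s n \<omega>)) sequentially"
      using elim(1) by eventually_elim auto
    moreover have "eventually (\<lambda>k. (2 ^ k) powr \<beta> < real (v (2 ^ k) \<omega>)) sequentially"
      using elim(2) by eventually_elim auto
    ultimately have "(\<lambda>n. real n / real (v n \<omega>) powr (real (s n \<omega>) / real n)) \<longlonglongrightarrow> 0"
      using x0 \<beta>0 \<beta>x by (intro edge_vertex_ratio_LIMSEQ) auto
    also have "(\<lambda>n. real n / real (v n \<omega>) powr (real (s n \<omega>) / real n))
       = (\<lambda>n. real (e_net (Y n \<omega>)) / real (v_net (Y n \<omega>)) powr m_avg (Y n \<omega>))"
      by (simp add: m_avg_eq e_net_def v_def s_def Y_def del: upt_Suc)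
    finally have "(\<lambda>n. ereal (real (e_net (Y n \<omega>)) / real (v_net (Y n \<omega>)) powr m_avg (Y n \<omega>))) \<longlonglongrightarrow> ereal 0"
      by (intro tendsto_ereal)
    thus ?case
      unfolding Y_def zero_ereal_def by (rule lim_imp_Limsup[OF sequentially_bot])
  qed
qed

end

theorem theorem5p3:
  fixes \<alpha> \<theta> :: real and \<nu> :: "nat pmf"
  assumes "0 < \<alpha>" and "\<alpha> < 1" and "\<theta> > - \<alpha>"
    and "pmf \<nu> 0 = 0"
    and "integrable (measure_pmf \<nu>) real"
  shows "(\<lambda>n. measure_pmf.expectation (hw_pmf \<alpha> \<theta> \<nu> n) (\<lambda>es. real (v_net es)))
           \<sim>[at_top] (\<lambda>n. Gamma (\<theta> + 1) / (\<alpha> * Gamma (\<theta> + \<alpha>))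
                          * (measure_pmf.expectation \<nu> real * real n) powr \<alpha>)
       \<and> (\<forall>(M :: 'a measure) (X :: nat \<Rightarrow> 'a \<Rightarrow> nat list).
           1 / measure_pmf.expectation \<nu> real < \<alpha> \<longrightarrow>
           prob_space M \<longrightarrow>
           (\<forall>i. X i \<in> measurable M (count_space UNIV)) \<longrightarrow>
           (\<forall>n. distr M (count_space UNIV) (\<lambda>\<omega>. map (\<lambda>i. X i \<omega>) [1..<Suc n])
                  = measure_pmf (hw_pmf \<alpha> \<theta> \<nu> n)) \<longrightarrow>
           (AE \<omega> in M. limsup (\<lambda>n. ereal (real (e_net (map (\<lambda>i. X i \<omega>) [1..<Suc n]))
                 / real (v_net (map (\<lambda>i. X i \<omega>) [1..<Suc n]))
                     powr m_avg (map (\<lambda>i. X i \<omega>) [1..<Suc n]))) = 0))"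
proof -
  interpret hollywood \<alpha> \<theta>
    using assms by unfold_locales auto
  show ?thesis
    using expectation_v_net_asymp_equiv[OF assms(4,5)] AE_sparse[OF assms(4,5)] by blast
qed

end
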